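(* If $\mathcal{G}$ is a finite simple graph containing no triangle ($3$-cycle) and no quadrangle ($4$-cycle), then $LE_{CN}(\mathcal{G})=LE(\mathcal{G}^{\dagger})$ and $LE^+_{CN}(\mathcal{G})=LE^+(\mathcal{G}^{\dagger})$, where $\mathcal{G}^{\dagger}$ is the derived graph of $\mathcal{G}$.
   Context: The derived graph $\mathcal{G}^\dagger$ has vertex set $V(\mathcal{G})$, two vertices being adjacent iff their distance in $\mathcal{G}$ is exactly two. For a graph $H$ on $p$ vertices with adjacency matrix $A(H)$ and degree matrix $D(H)$: $LE(H)=\sum_\beta|\beta-tr(D(H))/p|$ over eigenvalues of $L(H)=D(H)-A(H)$, and $LE^+(H)=\sum_\gamma|\gamma-tr(D(H))/p|$ over eigenvalues of $Q(H)=D(H)+A(H)$ (with multiplicity). For $\mathcal{G}$ on vertices $v_1,\dots,v_p$: $\mathrm{CN}(\mathcal{G})$ has $(i,j)$-entry $|N(v_i)\cap N(v_j)|$ for $i\neq j$ (open neighbourhoods) and $0$ on the diagonal; $\mathrm{CNRS}(\mathcal{G})$ is the diagonal matrix of its row sums; $\mathrm{CNL}=\mathrm{CNRS}-\mathrm{CN}$, $\mathrm{CNSL}=\mathrm{CNRS}+\mathrm{CN}$; $LE_{CN}(\mathcal{G})=\sum_\nu|\nu-tr(\mathrm{CNRS}(\mathcal{G}))/p|$ over eigenvalues of $\mathrm{CNL}(\mathcal{G})$, and $LE^+_{CN}(\mathcal{G})$ likewise with $\mathrm{CNSL}(\mathcal{G})$. *)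

theory Defs
  imports
    "Graph_Theory.Graph_Theory"
    "Jordan_Normal_Form.Char_Poly"
begin

text \<open>
  Finite simple graphs are the AFP's \<^locale>\<open>graph\<close>: finite, loop-free digraphs without parallel
  arcs and with a symmetric arc set, so every undirected edge is a pair of opposite arcs and
  \<^const>\<open>out_degree\<close> is the usual degree.  In such a graph a closed arc walk satisfying
  \<^const>\<open>pre_digraph.cycle\<close> with three (four) arcs is exactly an oriented triangle (quadrangle),
  since its vertices are pairwise distinct; the degenerate cycle u, v, u has only two arcs.
\<close>

definition graph_dist :: "('a, 'b) pre_digraph \<Rightarrow> 'a \<Rightarrow> 'a \<Rightarrow> ereal" where
  "graph_dist G u v = wf_digraph.\<mu> G (\<lambda>_. 1) u v"

definition derived_graph :: "('a, 'b) pre_digraph \<Rightarrow> ('a, 'a \<times> 'a) pre_digraph" where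
  "derived_graph G =
     \<lparr> verts = verts G,
       arcs = {(u, v). u \<in> verts G \<and> v \<in> verts G \<and> graph_dist G u v = 2},
       tail = fst, head = snd \<rparr>"

definition triangle_free :: "('a, 'b) pre_digraph \<Rightarrow> bool" where
  "triangle_free G \<longleftrightarrow> (\<nexists>p. pre_digraph.cycle G p \<and> length p = 3)"

definition quadrangle_free :: "('a, 'b) pre_digraph \<Rightarrow> bool" where
  "quadrangle_free G \<longleftrightarrow> (\<nexists>p. pre_digraph.cycle G p \<and> length p = 4)"

definition neighbourhood :: "('a, 'b) pre_digraph \<Rightarrow> 'a \<Rightarrow> 'a set" where
  "neighbourhood G v = {w. v \<rightarrow>\<^bsub>G\<^esub> w}"


text \<open>
  The matrices below depend on a list \<open>vs\<close> enumerating the vertices without repetition.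
\<close>

definition adj_mat :: "('a, 'b) pre_digraph \<Rightarrow> 'a list \<Rightarrow> real mat" where
  "adj_mat G vs = mat (length vs) (length vs)
     (\<lambda>(i, j). if vs ! i \<rightarrow>\<^bsub>G\<^esub> vs ! j then 1 else 0)"

definition deg_mat :: "('a, 'b) pre_digraph \<Rightarrow> 'a list \<Rightarrow> real mat" where
  "deg_mat G vs = mat (length vs) (length vs)
     (\<lambda>(i, j). if i = j then real (out_degree G (vs ! i)) else 0)"

definition CN :: "('a, 'b) pre_digraph \<Rightarrow> 'a list \<Rightarrow> real mat" where
  "CN G vs = mat (length vs) (length vs)
     (\<lambda>(i, j). if i = j then 0
               else real (card (neighbourhood G (vs ! i) \<inter> neighbourhood G (vs ! j))))"

definition CNRS :: "('a, 'b) pre_digraph \<Rightarrow> 'a list \<Rightarrow> real mat" where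
  "CNRS G vs = mat (length vs) (length vs)
     (\<lambda>(i, j). if i = j then (\<Sum>k<length vs. CN G vs $$ (i, k)) else 0)"

definition CNL :: "('a, 'b) pre_digraph \<Rightarrow> 'a list \<Rightarrow> real mat" where
  "CNL G vs = CNRS G vs - CN G vs"

definition CNSL :: "('a, 'b) pre_digraph \<Rightarrow> 'a list \<Rightarrow> real mat" where
  "CNSL G vs = CNRS G vs + CN G vs"

definition laplacian :: "('a, 'b) pre_digraph \<Rightarrow> 'a list \<Rightarrow> real mat" where
  "laplacian G vs = deg_mat G vs - adj_mat G vs"

definition signless_laplacian :: "('a, 'b) pre_digraph \<Rightarrow> 'a list \<Rightarrow> real mat" where
  "signless_laplacian G vs = deg_mat G vs + adj_mat G vs"

text \<open>
  \<open>spectral_dev M D\<close> sums $|\beta - \mathrm{tr}(D)/p|$ over the eigenvalues of the $p \times p$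
  matrix \<open>M\<close>, each weighted by its algebraic multiplicity.  It is only applied to real symmetric
  matrices, whose eigenvalues are all real, so summing over real eigenvalues loses nothing.
\<close>

definition spectral_dev :: "real mat \<Rightarrow> real mat \<Rightarrow> real" where
  "spectral_dev M D =
     (\<Sum>\<beta> | eigenvalue M \<beta>. real (Polynomial.order \<beta> (char_poly M)) *
        \<bar>\<beta> - sum_list (diag_mat D) / real (dim_row M)\<bar>)"

text \<open>
  The choice of enumeration is immaterial: see \<open>LE_eq\<close>, \<open>LE_plus_eq\<close>, \<open>LE_CN_eq\<close>,
  \<open>LE_CN_plus_eq\<close> below.
\<close>

definition vertex_enum :: "('a, 'b) pre_digraph \<Rightarrow> 'a list" where
  "vertex_enum G = (SOME vs. distinct vs \<and> set vs = verts G)"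

definition LE :: "('a, 'b) pre_digraph \<Rightarrow> real" where
  "LE G = spectral_dev (laplacian G (vertex_enum G)) (deg_mat G (vertex_enum G))"

definition LE_plus :: "('a, 'b) pre_digraph \<Rightarrow> real" where
  "LE_plus G = spectral_dev (signless_laplacian G (vertex_enum G)) (deg_mat G (vertex_enum G))"

definition LE_CN :: "('a, 'b) pre_digraph \<Rightarrow> real" where
  "LE_CN G = spectral_dev (CNL G (vertex_enum G)) (CNRS G (vertex_enum G))"

definition LE_CN_plus :: "('a, 'b) pre_digraph \<Rightarrow> real" where
  "LE_CN_plus G = spectral_dev (CNSL G (vertex_enum G)) (CNRS G (vertex_enum G))"


lemma (in graph) awalk_reverse:
  "awalk u p v \<Longrightarrow> \<exists>q. awalk v q u \<and> length q = length p"
proof (induction p arbitrary: u)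
  case Nil
  then show ?case by (auto simp: awalk_def)
next
  case (Cons e p)
  then have e: "e \<in> arcs G" "tail G e = u" and p: "awalk (head G e) p v"
    by (auto simp: awalk_Cons_iff)
  obtain q where q: "awalk v q (head G e)" "length q = length p" using Cons.IH[OF p] by blast
  obtain e' where e': "e' \<in> arcs G" "tail G e' = head G e" "head G e' = u"
    using sym_arcs e unfolding symmetric_conv by metis
  have "awalk (head G e) [e'] u" using e' e(1) by (auto simp: awalk_def)
  with q(1) have "awalk v (q @ [e']) u" by (rule awalk_appendI)
  then show ?case using q(2) by (intro exI[of _ "q @ [e']"]) simp
qed

lemma (in graph) graph_dist_alt:
  "graph_dist G u v = (INF n\<in>{length p |p. awalk u p v}. ereal (real n))"
proof -
  have "awalk_cost (\<lambda>_. 1) p = real (length p)" for p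
    by (induction p) auto
  then show ?thesis
    unfolding graph_dist_def \<mu>_def by (simp add: setcompr_eq_image image_image)
qed

lemma (in graph) graph_dist_commute: "graph_dist G u v = graph_dist G v u"
proof -
  have "{length p |p. awalk u p v} = {length p |p. awalk v p u}"
    using awalk_reverse by (metis (no_types, lifting))
  then show ?thesis by (simp add: graph_dist_alt)
qed

lemma (in graph) graph_dist_self:
  assumes "u \<in> verts G"
  shows "graph_dist G u u = 0"
proof (rule antisym)
  have "awalk u [] u" using assms by (simp add: awalk_def)
  then have "(0::nat) \<in> {length p |p. awalk u p u}" by force
  then have "graph_dist G u u \<le> ereal (real 0)"
    unfolding graph_dist_alt by (rule INF_lower)
  then show "graph_dist G u u \<le> 0" by (simp add: zero_ereal_def)
  show "0 \<le> graph_dist G u u" unfolding graph_dist_alt by (rule INF_greatest) simp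
qed

lemma (in graph) graph_derived_graph: "graph (derived_graph G)"
proof -
  have "finite (arcs (derived_graph G))"
    by (rule finite_subset[of _ "verts G \<times> verts G"]) (auto simp: derived_graph_def)
  moreover have "symmetric (derived_graph G)"
    by (auto simp: symmetric_conv derived_graph_def graph_dist_commute)
  ultimately show ?thesis
    by unfold_locales (auto simp: derived_graph_def arc_to_ends_def graph_dist_self)
qed

lemma vertex_enum:
  assumes "finite (verts G)"
  shows "distinct (vertex_enum G)" "set (vertex_enum G) = verts G"
proof -
  obtain vs where "distinct vs \<and> set vs = verts G"
    using finite_distinct_list[OF assms] by blast
  then have "distinct (vertex_enum G) \<and> set (vertex_enum G) = verts G"
    unfolding vertex_enum_def by (rule someI)
  then show "distinct (vertex_enum G)" "set (vertex_enum G) = verts G" by auto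
qed

definition kernel_mat :: "('a \<Rightarrow> 'a \<Rightarrow> real) \<Rightarrow> 'a list \<Rightarrow> real mat" where
  "kernel_mat K vs = mat (length vs) (length vs) (\<lambda>(i, j). K (vs ! i) (vs ! j))"

lemma similar_kernel_mat:
  assumes "distinct vs" "distinct ws" "set vs = set ws"
  shows "similar_mat (kernel_mat K vs) (kernel_mat K ws)"
proof -
  define n where "n = length vs"
  have n: "length vs = n" "length ws = n"
    using assms by (auto simp: n_def) (metis distinct_card)
  define P :: "real mat" where "P = mat n n (\<lambda>(i, j). if vs ! i = ws ! j then 1 else 0)"
  define Q :: "real mat" where "Q = mat n n (\<lambda>(i, j). if ws ! i = vs ! j then 1 else 0)"
  have vw: "\<exists>j<n. vs ! i = ws ! j" if "i < n" for i
    using that assms n by (metis in_set_conv_nth)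
  have wv: "\<exists>j<n. ws ! i = vs ! j" if "i < n" for i
    using that assms n by (metis in_set_conv_nth)
  have inj_v: "vs ! i = vs ! j \<longleftrightarrow> i = j" and inj_w: "ws ! i = ws ! j \<longleftrightarrow> i = j"
    if "i < n" "j < n" for i j
    using that assms n by (auto simp: nth_eq_iff_index_eq)
  have delta: "(\<Sum>k = 0..<n. if vs ! i = ws ! k then f k else (0::real)) = f j"
    if "i < n" "j < n" "vs ! i = ws ! j" for i j f
  proof -
    have "(\<Sum>k = 0..<n. if vs ! i = ws ! k then f k else 0) = (\<Sum>k = 0..<n. if k = j then f k else 0)"
      using that inj_w by (intro sum.cong) auto
    then show ?thesis using that by simp
  qed
  have delta': "(\<Sum>k = 0..<n. if ws ! i = vs ! k then f k else (0::real)) = f j"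
    if "i < n" "j < n" "ws ! i = vs ! j" for i j f
  proof -
    have "(\<Sum>k = 0..<n. if ws ! i = vs ! k then f k else 0) = (\<Sum>k = 0..<n. if k = j then f k else 0)"
      using that inj_v by (intro sum.cong) auto
    then show ?thesis using that by simp
  qed
  have PQ: "P * Q = 1\<^sub>m n"
  proof (rule eq_matI)
    fix i j assume "i < dim_row (1\<^sub>m n :: real mat)" "j < dim_col (1\<^sub>m n :: real mat)"
    then have ij: "i < n" "j < n" by auto
    obtain k where k: "k < n" "vs ! i = ws ! k" using vw ij by blast
    have "(P * Q) $$ (i, j) = (\<Sum>k = 0..<n. if vs ! i = ws ! k then (if ws ! k = vs ! j then 1 else 0) else 0)"
      using ij by (auto simp: P_def Q_def scalar_prod_def intro!: sum.cong)
    also have "\<dots> = (if ws ! k = vs ! j then 1 else 0)"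
      by (rule delta) (use ij k in auto)
    also have "\<dots> = 1\<^sub>m n $$ (i, j)" using ij k(2)[symmetric] inj_v by auto
    finally show "(P * Q) $$ (i, j) = 1\<^sub>m n $$ (i, j)" .
  qed (auto simp: P_def Q_def)
  have QP: "Q * P = 1\<^sub>m n"
    by (rule mat_mult_left_right_inverse[OF _ _ PQ]) (auto simp: P_def Q_def)
  have KP: "kernel_mat K vs * P = P * kernel_mat K ws"
  proof (rule eq_matI)
    fix i j assume "i < dim_row (P * kernel_mat K ws)" "j < dim_col (P * kernel_mat K ws)"
    then have ij: "i < n" "j < n" by (auto simp: P_def kernel_mat_def n)
    obtain k where k: "k < n" "vs ! i = ws ! k" using vw ij by blast
    obtain l where l: "l < n" "ws ! j = vs ! l" using wv ij by blast
    have "(kernel_mat K vs * P) $$ (i, j) = (\<Sum>k = 0..<n. if ws ! j = vs ! k then K (vs ! i) (vs ! k) else 0)"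
      using ij by (auto simp: P_def kernel_mat_def n scalar_prod_def intro!: sum.cong)
    also have "\<dots> = K (vs ! i) (vs ! l)" by (rule delta') (use ij l in auto)
    also have "\<dots> = K (ws ! k) (ws ! j)" using k l by simp
    also have "\<dots> = (\<Sum>k = 0..<n. if vs ! i = ws ! k then K (ws ! k) (ws ! j) else 0)"
      by (rule delta[symmetric]) (use ij k in auto)
    also have "\<dots> = (P * kernel_mat K ws) $$ (i, j)"
      using ij by (auto simp: P_def kernel_mat_def n scalar_prod_def intro!: sum.cong)
    finally show "(kernel_mat K vs * P) $$ (i, j) = (P * kernel_mat K ws) $$ (i, j)" .
  qed (auto simp: P_def kernel_mat_def n)
  have carr: "P \<in> carrier_mat n n" "Q \<in> carrier_mat n n"
    "kernel_mat K vs \<in> carrier_mat n n" "kernel_mat K ws \<in> carrier_mat n n"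
    by (auto simp: P_def Q_def kernel_mat_def n)
  have "kernel_mat K vs = kernel_mat K vs * (P * Q)" using PQ carr by simp
  also have "\<dots> = P * kernel_mat K ws * Q"
    using KP carr by (metis assoc_mult_mat)
  finally show ?thesis
    using PQ QP carr by (intro similar_matI[of _ _ P Q n]) auto
qed

lemma spectral_dev_kernel_mat:
  assumes "distinct vs" "distinct ws" "set vs = set ws"
  shows "spectral_dev (kernel_mat K vs) (kernel_mat D vs)
       = spectral_dev (kernel_mat K ws) (kernel_mat D ws)"
proof -
  have len: "length vs = length ws" using assms by (metis distinct_card)
  have cp: "char_poly (kernel_mat K vs) = char_poly (kernel_mat K ws)"
    by (rule char_poly_similar[OF similar_kernel_mat[OF assms]])
  have carr: "kernel_mat K us \<in> carrier_mat (length us) (length us)" for us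
    by (auto simp: kernel_mat_def)
  have ev: "eigenvalue (kernel_mat K vs) = eigenvalue (kernel_mat K ws)"
    using eigenvalue_root_char_poly[OF carr] cp by (intro ext) auto
  have tr: "sum_list (diag_mat (kernel_mat D us)) = (\<Sum>v\<in>set us. D v v)" if "distinct us" for us
  proof -
    have "diag_mat (kernel_mat D us) = map (\<lambda>v. D v v) us"
      by (rule nth_equalityI) (auto simp: diag_mat_def kernel_mat_def)
    then show ?thesis using that by (simp add: sum_list_distinct_conv_sum_set)
  qed
  show ?thesis
    unfolding spectral_dev_def using cp ev tr[OF assms(1)] tr[OF assms(2)] assms(3) len
    by (simp add: kernel_mat_def)
qed

context
  fixes G :: "('a, 'b) pre_digraph" and vs :: "'a list"
  assumes vs: "distinct vs" "set vs = verts G"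
begin

private definition "KA = (\<lambda>u v. if u \<rightarrow>\<^bsub>G\<^esub> v then 1 else 0 :: real)"
private definition "KD = (\<lambda>u v. if u = v then real (out_degree G u) else 0)"
private definition "KC = (\<lambda>u v. if u = v then 0
  else real (card (neighbourhood G u \<inter> neighbourhood G v)))"
private definition "KR = (\<lambda>u v. if u = v then (\<Sum>w\<in>verts G. KC u w) else 0)"

private lemma kernels:
  assumes "distinct us" "set us = verts G"
  shows "deg_mat G us = kernel_mat KD us"
    and "laplacian G us = kernel_mat (\<lambda>u v. KD u v - KA u v) us"
    and "signless_laplacian G us = kernel_mat (\<lambda>u v. KD u v + KA u v) us"
    and "CNRS G us = kernel_mat KR us"
    and "CNL G us = kernel_mat (\<lambda>u v. KR u v - KC u v) us"
    and "CNSL G us = kernel_mat (\<lambda>u v. KR u v + KC u v) us"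
proof -
  have A: "adj_mat G us = kernel_mat KA us"
    by (rule eq_matI) (auto simp: adj_mat_def kernel_mat_def KA_def)
  show D: "deg_mat G us = kernel_mat KD us"
    using assms
    by (intro eq_matI) (auto simp: deg_mat_def kernel_mat_def KD_def nth_eq_iff_index_eq)
  have C: "CN G us = kernel_mat KC us"
    using assms by (intro eq_matI) (auto simp: CN_def kernel_mat_def KC_def nth_eq_iff_index_eq)
  have sum: "(\<Sum>k<length us. KC u (us ! k)) = (\<Sum>w\<in>verts G. KC u w)" for u
    using assms sum.reindex_bij_betw[OF bij_betw_nth[OF assms(1) refl assms(2)[symmetric]]] by simp
  show R: "CNRS G us = kernel_mat KR us"
    using assms
    by (intro eq_matI)
       (auto simp: CNRS_def C kernel_mat_def KR_def nth_eq_iff_index_eq sum[symmetric])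
  show "laplacian G us = kernel_mat (\<lambda>u v. KD u v - KA u v) us"
    and "signless_laplacian G us = kernel_mat (\<lambda>u v. KD u v + KA u v) us"
    and "CNL G us = kernel_mat (\<lambda>u v. KR u v - KC u v) us"
    and "CNSL G us = kernel_mat (\<lambda>u v. KR u v + KC u v) us"
    unfolding laplacian_def signless_laplacian_def CNL_def CNSL_def A D C R
    by (intro eq_matI; auto simp: kernel_mat_def)+
qed

private lemma enum: "distinct (vertex_enum G)" "set (vertex_enum G) = verts G"
  using vertex_enum[of G] vs(2) by (metis List.finite_set)+

lemma LE_eq: "LE G = spectral_dev (laplacian G vs) (deg_mat G vs)"
  and LE_plus_eq: "LE_plus G = spectral_dev (signless_laplacian G vs) (deg_mat G vs)"
  and LE_CN_eq: "LE_CN G = spectral_dev (CNL G vs) (CNRS G vs)"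
  and LE_CN_plus_eq: "LE_CN_plus G = spectral_dev (CNSL G vs) (CNRS G vs)"
  unfolding LE_def LE_plus_def LE_CN_def LE_CN_plus_def kernels[OF vs] kernels[OF enum]
  by (rule spectral_dev_kernel_mat; use vs enum in simp)+

end

end

theory Submission
  imports Defs
begin

text \<open>
  Distinct vertices of a graph without quadrangles have at most one common neighbour, and without
  triangles two vertices with a common neighbour are not adjacent, hence at distance two.  So the
  common neighbourhood matrix is the adjacency matrix of the derived graph, its row sums are the
  degrees there, and both pairs of matrices coincide entry by entry.
\<close>

lemma dominates_derived_graph:
  "u \<rightarrow>\<^bsub>derived_graph G\<^esub> v \<longleftrightarrow> u \<in> verts G \<and> v \<in> verts G \<and> graph_dist G u v = 2"
  by (force simp: derived_graph_def arcs_ends_def arc_to_ends_def)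

text \<open>The choice in \<open>vertex_enum\<close> depends only on the vertex set, which both
  graphs share. Hence the two sides of the theorem use the same enumeration, and their matrices can
  be compared directly instead of up to similarity.\<close>

lemma vertex_enum_derived_graph: "vertex_enum (derived_graph G) = vertex_enum G"
  by (simp add: vertex_enum_def derived_graph_def)

context graph
begin

text \<open>Converts the condition on arc walks to adjacency: arcs realising the three adjacencies
  would form a \<open>cycle\<close>, whose vertices are distinct because there are no loops.\<close>

lemma triangle_freeD:
  assumes "triangle_free G" "u \<rightarrow>\<^bsub>G\<^esub> v" "v \<rightarrow>\<^bsub>G\<^esub> w"
  shows "\<not> w \<rightarrow>\<^bsub>G\<^esub> u"
proof
  assume "w \<rightarrow>\<^bsub>G\<^esub> u"
  with assms obtain a b c where
    "a \<in> arcs G" "tail G a = u" "head G a = v"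
    "b \<in> arcs G" "tail G b = v" "head G b = w"
    "c \<in> arcs G" "tail G c = w" "head G c = u"
    by (auto elim!: reachableE)
  moreover have "u \<noteq> v" "v \<noteq> w" "w \<noteq> u"
    using assms(2,3) \<open>w \<rightarrow>\<^bsub>G\<^esub> u\<close> adj_not_same by blast+
  ultimately have "cycle [a, b, c]"
    by (auto simp: cycle_def awalk_def)
  with assms(1) show False by (auto simp: triangle_free_def)
qed

lemma quadrangle_freeD:
  assumes "quadrangle_free G" "u \<rightarrow>\<^bsub>G\<^esub> w" "w \<rightarrow>\<^bsub>G\<^esub> v" "u \<rightarrow>\<^bsub>G\<^esub> x" "x \<rightarrow>\<^bsub>G\<^esub> v" "u \<noteq> v"
  shows "w = x"
proof (rule ccontr)
  assume "w \<noteq> x"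
  \<comment> \<open>The path from \<open>u\<close> through \<open>x\<close> to \<open>v\<close> is
    reversed, to close up the quadrangle \<open>u\<close>, \<open>w\<close>, \<open>v\<close>,
    \<open>x\<close>.\<close>
  have "v \<rightarrow>\<^bsub>G\<^esub> x" "x \<rightarrow>\<^bsub>G\<^esub> u" using assms graph_symmetric by auto
  with assms obtain a b c d where
    "a \<in> arcs G" "tail G a = u" "head G a = w"
    "b \<in> arcs G" "tail G b = w" "head G b = v"
    "c \<in> arcs G" "tail G c = v" "head G c = x"
    "d \<in> arcs G" "tail G d = x" "head G d = u"
    by (elim reachableE) blast
  moreover have "u \<noteq> w" "v \<noteq> w" "v \<noteq> x" "x \<noteq> u"
    using assms(2-5) adj_not_same by blast+
  ultimately have "cycle [a, b, c, d]"
    using assms(6) \<open>w \<noteq> x\<close>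
    by (auto simp: cycle_def awalk_def)
  with assms(1) show False by (auto simp: quadrangle_free_def)
qed

lemma graph_dist_eq_2_iff:
  assumes "triangle_free G" "u \<noteq> v"
  shows "graph_dist G u v = 2 \<longleftrightarrow> (\<exists>w. u \<rightarrow>\<^bsub>G\<^esub> w \<and> w \<rightarrow>\<^bsub>G\<^esub> v)"
proof
  assume *: "graph_dist G u v = 2"
  \<comment> \<open>A bound strictly above the infimum yields an actual walk; 3 leaves it at most
    two arcs, and the infimum itself gives at least two.\<close>
  then have "(INF n\<in>{length p |p. awalk u p v}. ereal (real n)) < 3"
    by (simp add: graph_dist_alt)
  then obtain p where p: "awalk u p v" "length p < 3"
    by (force simp: INF_less_iff)
  have "2 \<le> ereal (real (length p))"
    unfolding *[symmetric] graph_dist_alt using p by (intro INF_lower) auto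
  with p have "length p = 2" by simp
  then obtain a b where "p = [a, b]" by (auto simp: length_Suc_conv numeral_2_eq_2)
  with p(1) show "\<exists>w. u \<rightarrow>\<^bsub>G\<^esub> w \<and> w \<rightarrow>\<^bsub>G\<^esub> v"
    by (auto simp: awalk_simps dest!: in_arcs_imp_in_arcs_ends)
next
  assume "\<exists>w. u \<rightarrow>\<^bsub>G\<^esub> w \<and> w \<rightarrow>\<^bsub>G\<^esub> v"
  then obtain w where w: "u \<rightarrow>\<^bsub>G\<^esub> w" "w \<rightarrow>\<^bsub>G\<^esub> v" by blast
  then obtain a b where ab:
    "a \<in> arcs G" "tail G a = u" "head G a = w"
    "b \<in> arcs G" "tail G b = w" "head G b = v"
    by (elim reachableE) blast
  have "awalk u [a, b] v" using ab by (auto simp: awalk_def)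
  then have "(2::nat) \<in> {length p |p. awalk u p v}" by force
  then have "graph_dist G u v \<le> ereal (real 2)"
    unfolding graph_dist_alt by (rule INF_lower)
  \<comment> \<open>Otherwise \<open>u\<close>, \<open>w\<close>, \<open>v\<close> would be a
    triangle.\<close>
  moreover have "\<not> u \<rightarrow>\<^bsub>G\<^esub> v"
    using triangle_freeD[OF assms(1) w] graph_symmetric by blast
  have "2 \<le> length p" if "awalk u p v" for p
  proof (rule ccontr)
    assume "\<not> 2 \<le> length p"
    \<comment> \<open>The empty walk is excluded by \<open>u \<noteq> v\<close>, so a single arc
      remains.\<close>
    with that assms(2) obtain e where "p = [e]"
      by (cases p) (auto simp: Suc_le_eq)
    with that \<open>\<not> u \<rightarrow>\<^bsub>G\<^esub> v\<close> show False
      by (auto simp: awalk_Cons_iff dest!: in_arcs_imp_in_arcs_ends)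
  qed
  then have "ereal 2 \<le> graph_dist G u v"
    unfolding graph_dist_alt by (intro INF_greatest) auto
  ultimately show "graph_dist G u v = 2" by simp
qed

text \<open>Common neighbours are the midpoints of two-arc walks: distance two decides whether one
  exists, and a second one would create a quadrangle.\<close>

lemma card_common_neighbours:
  assumes "triangle_free G" "quadrangle_free G" "u \<noteq> v"
  shows "card (neighbourhood G u \<inter> neighbourhood G v) = (if graph_dist G u v = 2 then 1 else 0)"
proof -
  have eq: "neighbourhood G u \<inter> neighbourhood G v = {w. u \<rightarrow>\<^bsub>G\<^esub> w \<and> w \<rightarrow>\<^bsub>G\<^esub> v}"
    using graph_symmetric by (auto simp: neighbourhood_def)
  show ?thesis
  proof (cases "graph_dist G u v = 2")
    case True
    then obtain w where "u \<rightarrow>\<^bsub>G\<^esub> w" "w \<rightarrow>\<^bsub>G\<^esub> v"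
      using graph_dist_eq_2_iff assms by blast
    then have "{w. u \<rightarrow>\<^bsub>G\<^esub> w \<and> w \<rightarrow>\<^bsub>G\<^esub> v} = {w}"
      using quadrangle_freeD[OF assms(2)] assms(3) by blast
    with True eq show ?thesis by simp
  next
    case False
    then have "{w. u \<rightarrow>\<^bsub>G\<^esub> w \<and> w \<rightarrow>\<^bsub>G\<^esub> v} = {}"
      using graph_dist_eq_2_iff assms by blast
    with False eq show ?thesis by simp
  qed
qed

lemma CN_eq_adj_mat_derived_graph:
  assumes "triangle_free G" "quadrangle_free G" "distinct vs" "set vs = verts G"
  shows "CN G vs = adj_mat (derived_graph G) vs"
proof (rule eq_matI)
  fix i j assume "i < dim_row (adj_mat (derived_graph G) vs)" "j < dim_col (adj_mat (derived_graph G) vs)"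
  then have ij: "i < length vs" "j < length vs" by (auto simp: adj_mat_def)
  then have "vs ! i \<in> verts G" "vs ! j \<in> verts G" using assms(4) by auto
  moreover have "vs ! i = vs ! j \<longleftrightarrow> i = j" using ij assms(3) by (simp add: nth_eq_iff_index_eq)
  \<comment> \<open>On the diagonal both entries vanish, since a vertex has distance 0 from
    itself.\<close>
  ultimately show "CN G vs $$ (i, j) = adj_mat (derived_graph G) vs $$ (i, j)"
    using ij card_common_neighbours[OF assms(1,2)]
    by (auto simp: CN_def adj_mat_def dominates_derived_graph graph_dist_self)
qed (auto simp: CN_def adj_mat_def)

text \<open>\<open>out_degree\<close> counts arcs; as the arcs of the derived graph are vertex
  pairs, \<open>Pair u\<close> matches neighbours of \<open>u\<close> with arcs leaving
  \<open>u\<close>.\<close>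

lemma out_degree_derived_graph:
  assumes "u \<in> verts G"
  shows "out_degree (derived_graph G) u = card {v. u \<rightarrow>\<^bsub>derived_graph G\<^esub> v}"
proof -
  have "out_arcs (derived_graph G) u = Pair u ` {v. u \<rightarrow>\<^bsub>derived_graph G\<^esub> v}"
    by (auto simp: out_arcs_def dominates_derived_graph) (auto simp: derived_graph_def assms)
  then show ?thesis by (simp add: out_degree_def card_image inj_on_def)
qed

lemma CNRS_eq_deg_mat_derived_graph:
  assumes "triangle_free G" "quadrangle_free G" "distinct vs" "set vs = verts G"
  shows "CNRS G vs = deg_mat (derived_graph G) vs"
proof -
  let ?H = "derived_graph G"
  have "(\<Sum>k<length vs. CN G vs $$ (i, k)) = real (out_degree ?H (vs ! i))" if i: "i < length vs" for i
  proof -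
    have "(\<Sum>k<length vs. CN G vs $$ (i, k)) = (\<Sum>k<length vs. if vs ! i \<rightarrow>\<^bsub>?H\<^esub> vs ! k then 1 else 0)"
      using i by (simp add: CN_eq_adj_mat_derived_graph[OF assms] adj_mat_def)
    \<comment> \<open>The enumeration is a bijection from indices to vertices, so the 0/1 row sum
      counts neighbours.\<close>
    also have "\<dots> = (\<Sum>v\<in>verts G. if vs ! i \<rightarrow>\<^bsub>?H\<^esub> v then 1 else 0)"
      by (rule sum.reindex_bij_betw[OF bij_betw_nth[OF assms(3) refl assms(4)[symmetric]]])
    also have "\<dots> = real (card {v \<in> verts G. vs ! i \<rightarrow>\<^bsub>?H\<^esub> v})"
      by (simp flip: sum.inter_filter)
    also have "{v \<in> verts G. vs ! i \<rightarrow>\<^bsub>?H\<^esub> v} = {v. vs ! i \<rightarrow>\<^bsub>?H\<^esub> v}"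
      by (auto simp: dominates_derived_graph)
    also have "card \<dots> = out_degree ?H (vs ! i)"
      using i assms(4) by (intro out_degree_derived_graph[symmetric]) auto
    finally show ?thesis .
  qed
  then show ?thesis by (intro eq_matI) (auto simp: CNRS_def deg_mat_def)
qed

end

theorem theorem4p8:
  fixes G :: "('a, 'b) pre_digraph"
  assumes "graph G"
    and "triangle_free G"
    and "quadrangle_free G"
  shows "LE_CN G = LE (derived_graph G) \<and> LE_CN_plus G = LE_plus (derived_graph G)"
proof -
  interpret graph G by (rule assms(1))
  note enum = vertex_enum[OF finite_verts]
  note mats = CN_eq_adj_mat_derived_graph[OF assms(2,3) enum]
    CNRS_eq_deg_mat_derived_graph[OF assms(2,3) enum]
  show ?thesis
    by (simp add: LE_CN_def LE_CN_plus_def LE_def LE_plus_def CNL_def CNSL_def laplacian_def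
        signless_laplacian_def vertex_enum_derived_graph mats)
qed

end
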